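(* Let $K\ge1$ and $C>0$ be constants. Suppose that, for each $n$, there is a (classical, randomized) algorithm that makes at most $t=t(n)$ queries to $O_A$ and, for every nonempty $A\subseteq\mathbb{F}_2^n$ with $|A+A|\le K|A|$, outputs with non-negligible probability a linear subspace $H\le\mathbb{F}_2^n$ with $|H|\le|A|$ such that $A$ is covered by at most $(2K)^C$ cosets of $H$. Then $t=\Omega_K(n^2)$.
   Context: $A+A=\{a+a':a,a'\in A\}$. The oracle $O_A$, on input $x\in\mathbb{F}_2^n$, returns $\mathbf{1}_A(x)\in\{0,1\}$, and it is the algorithm's only access to $A$ (there is no random-sample access). "Non-negligible probability" means probability at least $n^{-a}$ for some constant $a>0$ and all sufficiently large $n$. $t=\Omega_K(n^2)$ means there is a constant $c>0$, which may depend on $K$, with $t(n)\ge cn^2$ for all sufficiently large $n$ (depending on $K$, $C$, $a$). *)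

theory Defs
  imports
    "HOL-Library.Z2"
    "HOL-Library.Set_Algebras"
    "HOL-Probability.Probability_Mass_Function"
    "Jordan_Normal_Form.VS_Connect"
begin

text \<open>
  \<open>\<bbbF>\<^sub>2\<^sup>n\<close> is the space of \<open>n\<close>-dimensional vectors over the two-element field \<^typ>\<open>bit\<close>. It is a
  carrier inside one type, since \<open>n\<close> ranges over all natural numbers within the statement.
\<close>

abbreviation F2 :: "nat \<Rightarrow> bit vec set" where
  "F2 n \<equiv> carrier_vec n"

definition linear_subspace :: "nat \<Rightarrow> bit vec set \<Rightarrow> bool" where
  "linear_subspace n H \<longleftrightarrow> VectorSpace.subspace class_ring H (module_vec TYPE(bit) n)"

definition covered_by_cosets :: "nat \<Rightarrow> bit vec set \<Rightarrow> real \<Rightarrow> bit vec set \<Rightarrow> bool" where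
  "covered_by_cosets n H m A \<longleftrightarrow>
     (\<exists>\<C>. \<C> \<subseteq> {x +o H | x. x \<in> F2 n} \<and> finite \<C> \<and> real (card \<C>) \<le> m \<and> A \<subseteq> \<Union>\<C>)"

text \<open>
  A classical randomized query algorithm with outputs in \<open>'h\<close>: it stops with an output, or queries
  the oracle at a vector and continues depending on the answer, or flips coins (of an arbitrary
  discrete distribution) and continues depending on the result. Computation and coin flips are
  free, and queries may depend on all earlier answers and coins. A query outside \<open>\<bbbF>\<^sub>2\<^sup>n\<close> is not
  forbidden, but for \<open>A \<subseteq> \<bbbF>\<^sub>2\<^sup>n\<close> it is always answered negatively and still counts as a query.
\<close>

datatype 'h query_alg =
    Output 'h
  | Query "bit vec" "bool \<Rightarrow> 'h query_alg"
  | Flip "'h query_alg pmf"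

definition membership_oracle :: "bit vec set \<Rightarrow> bit vec \<Rightarrow> bool" where
  "membership_oracle A x \<longleftrightarrow> x \<in> A"

text \<open>The joint distribution of the output and of the number of queries made.\<close>

primrec run :: "(bit vec \<Rightarrow> bool) \<Rightarrow> 'h query_alg \<Rightarrow> ('h \<times> nat) pmf" where
  "run orc (Output h) = return_pmf (h, 0)"
| "run orc (Query x k) = map_pmf (\<lambda>(h, q). (h, Suc q)) (run orc (k (orc x)))"
| "run orc (Flip p) = join_pmf (map_pmf (run orc) p)"

definition makes_at_most_queries :: "nat \<Rightarrow> nat \<Rightarrow> 'h query_alg \<Rightarrow> bool" where
  "makes_at_most_queries n t alg \<longleftrightarrow>
     (\<forall>A \<subseteq> F2 n. \<forall>(h, q) \<in> set_pmf (run (membership_oracle A) alg). q \<le> t)"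

definition output_prob :: "bit vec set \<Rightarrow> 'h query_alg \<Rightarrow> ('h \<Rightarrow> bool) \<Rightarrow> real" where
  "output_prob A alg P = measure_pmf.prob (run (membership_oracle A) alg) {(h, q). P h}"

definition good_output :: "real \<Rightarrow> real \<Rightarrow> nat \<Rightarrow> bit vec set \<Rightarrow> bit vec set \<Rightarrow> bool" where
  "good_output K C n A H \<longleftrightarrow>
     linear_subspace n H \<and> card H \<le> card A \<and> covered_by_cosets n H ((2 * K) powr C) A"

text \<open>
  Success with probability at least \<open>n\<^sup>-\<^sup>a\<close>, on every nonempty set of doubling at most \<open>K\<close>. Here
  \<open>A + A\<close> is the sumset of \<^theory>\<open>HOL-Library.Set_Algebras\<close>.
\<close>

definition succeeds :: "real \<Rightarrow> real \<Rightarrow> real \<Rightarrow> nat \<Rightarrow> bit vec set query_alg \<Rightarrow> bool" where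
  "succeeds K C a n alg \<longleftrightarrow>
     (\<forall>A \<subseteq> F2 n. A \<noteq> {} \<and> real (card (A + A)) \<le> K * real (card A) \<longrightarrow>
        output_prob A alg (good_output K C n A) \<ge> real n powr (- a))"

end

theory Submission
  imports Defs
begin

text \<open>
  The bound is information-theoretic, and linear subspaces are already hard instances: a subspace
  has doubling \<open>1\<close>, so the algorithm must succeed on it for every \<open>K \<ge> 1\<close>. Write \<open>n = m + k\<close> with
  \<open>m = \<lfloor>n / 2\<rfloor>\<close> and consider the graphs \<open>{(x, M x)}\<close> of all linear maps \<open>M\<close> from \<open>\<bbbF>\<^sub>2\<^sup>m\<close> to
  \<open>\<bbbF>\<^sub>2\<^sup>k\<close>. There are \<open>2\<^bsup>mk\<^esup>\<close> of them, with \<open>mk \<ge> (n\<^sup>2 - 1) / 4\<close>.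

  One answer \<open>H\<close> is good for only \<open>2\<^bsup>O(n)\<^esup>\<close> of these graphs (\<open>card_good_graphs_le\<close>).
  Suppose that \<open>r\<close> cosets of \<open>H\<close> cover some graph, where \<open>r = \<lfloor>(2K)\<^sup>C\<rfloor>\<close>. The projection of the graph
  to \<open>\<bbbF>\<^sub>2\<^sup>m\<close> is onto, so the projection of \<open>H\<close> has at least \<open>2\<^sup>m / r\<close> elements; as \<open>H\<close> itself has at
  most \<open>2\<^sup>m\<close>, each of its cosets has at most \<open>r\<close> points above any given \<open>x\<close> (\<open>card_fibre_le\<close>).
  Once the \<open>r\<close> cosets are chosen, which is possible in at most \<open>2\<^bsup>nr\<^esup>\<close> ways, each of the \<open>m\<close> columns
  of \<open>M\<close> therefore has at most \<open>r\<^sup>2\<close> possible values.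

  An algorithm with \<open>t\<close> queries sees one of at most \<open>2\<^sup>t\<close> sequences of answers, so for fixed coins it
  gives at most \<open>2\<^sup>t\<close> different outputs. Hence its success probabilities on all graphs add up to at
  most \<open>2\<^sup>t \<cdot> 2\<^bsup>O(n)\<^esup>\<close> (\<open>sum_output_prob_le\<close>). Since each of them is at least \<open>n\<^bsup>-a\<^esup>\<close>, this forces
  \<open>t \<ge> mk - O(n)\<close>. The constants \<open>C\<close> and \<open>a\<close> enter only the linear term, so \<open>c = 1/8\<close> suffices.
\<close>

section \<open>Few queries, few successes\<close>

lemma output_prob_Output:
  "output_prob A (Output h) P = (if P h then 1 else 0)"
  by (simp add: output_prob_def)

lemma output_prob_Query:
  "output_prob A (Query x k) P = output_prob A (k (x \<in> A)) P"
  by (simp add: output_prob_def membership_oracle_def vimage_def case_prod_unfold)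

lemma output_prob_Flip:
  "output_prob A (Flip p) P = (\<integral>alg. output_prob A alg P \<partial>measure_pmf p)"
proof -
  have "run (membership_oracle A) (Flip p) = bind_pmf p (run (membership_oracle A))"
    by (simp add: bind_return_pmf' join_eq_bind_pmf bind_map_pmf)
  then show ?thesis
    unfolding output_prob_def
    by (simp only: measure_pmf_bind)
      (rule measure_pmf.measure_bind[where N = "count_space UNIV"];
        simp add: measure_pmf_in_subprob_algebra)
qed

lemma output_prob_le_1: "output_prob A alg P \<le> 1"
  by (simp add: output_prob_def)

lemma output_prob_nonneg: "0 \<le> output_prob A alg P"
  by (simp add: output_prob_def)

text \<open>
  The counting form of Yao's principle. A query splits the family of inputs into two parts by the
  answer, and the remaining algorithm has one query less on each, which costs a factor of \<open>2\<close>; coin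
  flips only average. The query bound is imposed on the inputs of the family only, so that the
  remaining algorithm inherits it on each part.
\<close>

lemma sum_output_prob_le:
  fixes P :: "'i \<Rightarrow> 'h \<Rightarrow> bool" and A :: "'i \<Rightarrow> bit vec set"
  assumes "finite I"
    and "\<And>h. card {i \<in> I. P i h} \<le> B"
    and "\<And>i h q. i \<in> I \<Longrightarrow> (h, q) \<in> set_pmf (run (membership_oracle (A i)) alg) \<Longrightarrow> q \<le> t"
  shows "(\<Sum>i\<in>I. output_prob (A i) alg (P i)) \<le> 2 ^ t * real B"
  using assms
proof (induction alg arbitrary: I t)
  case (Output h)
  have "(\<Sum>i\<in>I. output_prob (A i) (Output h) (P i)) = real (card {i \<in> I. P i h})"
    using Output.prems(1) by (simp add: output_prob_Output sum.If_cases Int_def)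
  also have "\<dots> \<le> real B"
    using Output.prems(2) by simp
  also have "\<dots> \<le> 2 ^ t * real B"
    by (simp add: mult_le_cancel_right1)
  finally show ?case .
next
  case (Query x k)
  define I' where "I' b = {i \<in> I. (x \<in> A i) = b}" for b
  have fin: "finite (I' b)" for b
    using Query.prems(1) by (simp add: I'_def)
  have qb: "Suc q \<le> t" if "i \<in> I' b" "(h, q) \<in> set_pmf (run (membership_oracle (A i)) (k b))" for i b h q
  proof (rule Query.prems(3))
    show "i \<in> I" "(h, Suc q) \<in> set_pmf (run (membership_oracle (A i)) (Query x k))"
      using that by (auto simp: I'_def membership_oracle_def image_iff intro: bexI[of _ "(h, q)"])
  qed
  have half: "(\<Sum>i\<in>I' b. output_prob (A i) (Query x k) (P i)) \<le> 2 ^ t * real B / 2" for b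
  proof (cases "I' b = {}")
    case True
    then show ?thesis by simp
  next
    case False
    then obtain i where i: "i \<in> I' b" by auto
    \<comment> \<open>The query just made counts, so it is within the budget and \<open>t - 1\<close> does not truncate.\<close>
    obtain h q where "(h, q) \<in> set_pmf (run (membership_oracle (A i)) (k b))"
      by (metis set_pmf_not_empty equals0I surj_pair)
    with qb i have "t > 0" by fastforce
    have "card {i \<in> I' b. P i h} \<le> B" for h
    proof -
      have "card {i \<in> I' b. P i h} \<le> card {i \<in> I. P i h}"
        using Query.prems(1) by (intro card_mono) (auto simp: I'_def)
      with Query.prems(2)[of h] show ?thesis by simp
    qed
    then have "(\<Sum>i\<in>I' b. output_prob (A i) (k b) (P i)) \<le> 2 ^ (t - 1) * real B"
      using fin qb by (intro Query.IH) (auto, fastforce)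
    moreover have "(\<Sum>i\<in>I' b. output_prob (A i) (Query x k) (P i))
        = (\<Sum>i\<in>I' b. output_prob (A i) (k b) (P i))"
      by (intro sum.cong) (auto simp: output_prob_Query I'_def)
    ultimately show ?thesis
      using \<open>t > 0\<close> by (simp add: power_diff)
  qed
  have "I = I' True \<union> I' False" "I' True \<inter> I' False = {}"
    by (auto simp: I'_def)
  then have "(\<Sum>i\<in>I. output_prob (A i) (Query x k) (P i))
      = (\<Sum>i\<in>I' True. output_prob (A i) (Query x k) (P i))
        + (\<Sum>i\<in>I' False. output_prob (A i) (Query x k) (P i))"
    using sum.union_disjoint[OF fin fin, of True False] by simp
  with half[of True] half[of False] show ?case by simp
next
  case (Flip p)
  have int: "integrable (measure_pmf p) (\<lambda>alg. output_prob (A i) alg (P i))" for i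
    by (rule measure_pmf.integrable_const_bound[where B = 1])
      (auto simp: output_prob_nonneg output_prob_le_1)
  have "(\<Sum>i\<in>I. output_prob (A i) (Flip p) (P i))
      = (\<integral>alg. (\<Sum>i\<in>I. output_prob (A i) alg (P i)) \<partial>measure_pmf p)"
    by (simp add: output_prob_Flip int)
  also have "\<dots> \<le> 2 ^ t * real B"
  proof (rule measure_pmf.integral_le_const)
    show "AE alg in measure_pmf p. (\<Sum>i\<in>I. output_prob (A i) alg (P i)) \<le> 2 ^ t * real B"
      unfolding AE_measure_pmf_iff
    proof
      fix alg assume alg: "alg \<in> set_pmf p"
      show "(\<Sum>i\<in>I. output_prob (A i) alg (P i)) \<le> 2 ^ t * real B"
        using alg Flip.prems(1,2)
      proof (rule Flip.IH)
        show "q \<le> t" if "i \<in> I" "(h, q) \<in> set_pmf (run (membership_oracle (A i)) alg)" for i h q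
          using that alg by (intro Flip.prems(3)[of i h q]) (auto simp: join_eq_bind_pmf)
      qed
    qed
  qed (simp add: int)
  finally show ?case .
qed

section \<open>Vectors over the two-element field\<close>

lemma card_F2: "card (F2 n) = 2 ^ n"
proof -
  have U: "(UNIV :: bit set) = {0, 1}"
    by (auto intro: bit_not_zero_iff[THEN iffD1])
  have "bij_betw (vec n) ({..<n} \<rightarrow>\<^sub>E (UNIV :: bit set)) (F2 n)"
    by (rule bij_betw_byWitness[where f' = "\<lambda>v. restrict (vec_index v) {..<n}"])
      (auto simp: PiE_def extensional_def fun_eq_iff)
  then have "card (F2 n) = card ({..<n} \<rightarrow>\<^sub>E (UNIV :: bit set))"
    by (simp add: bij_betw_same_card)
  also have "\<dots> = 2 ^ n"
    by (subst card_funcsetE) (simp_all add: U numeral_2_eq_2)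
  finally show ?thesis .
qed

lemma finite_F2 [simp]: "finite (F2 n)"
  by (rule card_ge_0_finite) (simp add: card_F2)

lemma bit_add_self: "(x :: bit) + x = 0"
  by (cases x rule: bit.exhaust) simp_all

text \<open>Addition is its own inverse; subtraction is avoided throughout in favour of this rule.\<close>

lemma F2_add_cancel:
  assumes "x \<in> F2 n" "y \<in> F2 n"
  shows "x + (x + y) = y"
  using assms by (intro eq_vecI) (auto simp: add.assoc[symmetric] bit_add_self simp del: add_bit_eq_xor)

lemma linear_subspaceD:
  assumes "linear_subspace n H"
  shows "H \<subseteq> F2 n" "x \<in> H \<Longrightarrow> y \<in> H \<Longrightarrow> x + y \<in> H"
proof -
  interpret submodule class_ring H "module_vec TYPE(bit) n"
    using assms unfolding linear_subspace_def by (rule subspace.submod)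
  show "H \<subseteq> F2 n"
    using subset by (simp add: module_vec_def)
  show "x \<in> H \<Longrightarrow> y \<in> H \<Longrightarrow> x + y \<in> H"
    using m_closed[of x y] by (simp add: module_vec_def)
qed

section \<open>Graphs of linear maps\<close>

text \<open>
  A linear map is given by the images \<open>f j\<close> of the unit vectors, the columns of its matrix. This makes
  the family of all maps a product set, in which conditions on single columns are easy to count.
\<close>

definition linear_graph :: "nat \<Rightarrow> nat \<Rightarrow> (nat \<Rightarrow> bit vec) \<Rightarrow> bit vec set" where
  "linear_graph m k f = (\<lambda>x. x @\<^sub>v (mat k m (\<lambda>(i, j). f j $ i) *\<^sub>v x)) ` F2 m"

lemma linear_graph_subset: "linear_graph m k f \<subseteq> F2 (m + k)"
  by (auto simp: linear_graph_def intro!: append_carrier_vec mult_mat_vec_carrier)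

lemma card_linear_graph: "card (linear_graph m k f) = 2 ^ m"
proof -
  have "inj_on (\<lambda>x. x @\<^sub>v (mat k m (\<lambda>(i, j). f j $ i) *\<^sub>v x)) (F2 m)"
    by (rule inj_onI) (auto simp: append_vec_eq[of _ m])
  then show ?thesis
    by (simp add: linear_graph_def card_image card_F2)
qed

lemma linear_graph_sumset: "linear_graph m k f + linear_graph m k f \<subseteq> linear_graph m k f"
proof
  fix v assume "v \<in> linear_graph m k f + linear_graph m k f"
  then obtain x y where xy: "x \<in> F2 m" "y \<in> F2 m"
    and v: "v = (x @\<^sub>v (mat k m (\<lambda>(i, j). f j $ i) *\<^sub>v x)) + (y @\<^sub>v (mat k m (\<lambda>(i, j). f j $ i) *\<^sub>v y))"
    by (auto simp: linear_graph_def elim!: set_plus_elim)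
  have "v = (x + y) @\<^sub>v (mat k m (\<lambda>(i, j). f j $ i) *\<^sub>v (x + y))"
    unfolding v using xy
    by (subst append_vec_add[of _ m _ _ k])
      (auto simp: mult_add_distrib_mat_vec[of _ k m] intro!: mult_mat_vec_carrier)
  then show "v \<in> linear_graph m k f"
    using xy by (simp add: linear_graph_def)
qed

text \<open>A graph determines its map: the columns can be read off above the unit vectors.\<close>

lemma unit_vec_in_linear_graph:
  assumes "j < m" "f j \<in> F2 k"
  shows "unit_vec m j @\<^sub>v f j \<in> linear_graph m k f"
proof -
  have "mat k m (\<lambda>(i, j). f j $ i) *\<^sub>v unit_vec m j = f j"
    using assms by (intro eq_vecI) auto
  then show ?thesis
    unfolding linear_graph_def by (intro image_eqI[of _ _ "unit_vec m j"]) auto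
qed

section \<open>Counting the graphs covered by few cosets\<close>

text \<open>
  Let \<open>Y\<close> be the fibre and fix \<open>y\<^sub>0 \<in> Y\<close>; then \<open>(0, y\<^sub>0 + y) \<in> H\<close> for all \<open>y \<in> Y\<close>. By the covering
  hypothesis every \<open>x\<close> has some \<open>i(x) < r\<close> and some \<open>h(x) \<in> H\<close> with first component \<open>x\<close> up to the shift
  by the representative \<open>s(i(x))\<close>. The pair of \<open>i(x)\<close> and \<open>h(x) + (0, y\<^sub>0 + y)\<close> determines first \<open>x\<close>
  and then \<open>y\<close>. This embeds \<open>\<bbbF>\<^sub>2\<^sup>m \<times> Y\<close> into \<open>{..<r} \<times> H\<close>, so that \<open>2\<^sup>m |Y| \<le> r |H| \<le> r 2\<^sup>m\<close>.
\<close>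

lemma card_fibre_le:
  assumes H: "H \<subseteq> F2 (m + k)" "\<And>x y. x \<in> H \<Longrightarrow> y \<in> H \<Longrightarrow> x + y \<in> H" "card H \<le> 2 ^ m"
    and s: "\<And>i. i < r \<Longrightarrow> s i \<in> F2 (m + k)"
    and cover: "\<And>x. x \<in> F2 m \<Longrightarrow> \<exists>i<r. \<exists>y\<in>F2 k. x @\<^sub>v y \<in> s i +o H"
    and u: "u \<in> F2 m" and z: "z \<in> F2 (m + k)"
  shows "card {y \<in> F2 k. u @\<^sub>v y \<in> z +o H} \<le> r"
proof (cases "{y \<in> F2 k. u @\<^sub>v y \<in> z +o H} = {}")
  case True
  then show ?thesis by (metis card.empty zero_le)
next
  case False
  define Y where "Y = {y \<in> F2 k. u @\<^sub>v y \<in> z +o H}"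
  obtain y0 where y0: "y0 \<in> Y"
    using False by (auto simp: Y_def)
  have YF: "Y \<subseteq> F2 k"
    by (auto simp: Y_def)
  obtain i g where ig: "\<And>x. x \<in> F2 m \<Longrightarrow> i x < r \<and> g x \<in> F2 k \<and> x @\<^sub>v g x \<in> s (i x) +o H"
    using cover by metis
  define h where "h x = s (i x) + (x @\<^sub>v g x)" for x
  have diff: "a + v \<in> H" if "a \<in> F2 (m + k)" "v \<in> a +o H" for a v
    using that H(1) F2_add_cancel[of a "m + k"] by (auto simp: elt_set_plus_def)
  have app: "x @\<^sub>v y \<in> F2 (m + k)" if "x \<in> F2 m" "y \<in> F2 k" for x y
    using that by auto
  have h: "h x \<in> H" if "x \<in> F2 m" for x
    using ig[OF that] s diff by (auto simp: h_def)
  have diff_Y: "0\<^sub>v m @\<^sub>v (y0 + y) \<in> H" if y: "y \<in> Y" for y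
  proof -
    have "y \<in> F2 k" "y0 \<in> F2 k"
      using y y0 YF by auto
    have "z + (u @\<^sub>v y0) \<in> H" "z + (u @\<^sub>v y) \<in> H"
      using y y0 diff[OF z] by (auto simp: Y_def)
    then have "(z + (u @\<^sub>v y0)) + (z + (u @\<^sub>v y)) \<in> H"
      by (rule H(2))
    also have "(z + (u @\<^sub>v y0)) + (z + (u @\<^sub>v y)) = z + (z + ((u @\<^sub>v y0) + (u @\<^sub>v y)))"
      using z app[OF u \<open>y \<in> F2 k\<close>] app[OF u \<open>y0 \<in> F2 k\<close>]
      by (intro eq_vecI) (auto simp: ac_simps simp del: add_bit_eq_xor)
    also have "\<dots> = (u @\<^sub>v y0) + (u @\<^sub>v y)"
      using z app[OF u \<open>y \<in> F2 k\<close>] app[OF u \<open>y0 \<in> F2 k\<close>]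
      by (intro F2_add_cancel[of _ "m + k"]) auto
    also have "\<dots> = (u + u) @\<^sub>v (y0 + y)"
      by (rule append_vec_add[OF u u \<open>y0 \<in> F2 k\<close> \<open>y \<in> F2 k\<close>])
    also have "u + u = 0\<^sub>v m"
      using u by (intro eq_vecI) (auto simp: bit_add_self simp del: add_bit_eq_xor)
    finally show ?thesis .
  qed
  define \<Phi> where "\<Phi> = (\<lambda>(x, y). (i x, h x + (0\<^sub>v m @\<^sub>v (y0 + y))))"
  have "inj_on \<Phi> (F2 m \<times> Y)"
  proof (rule inj_onI, clarify)
    fix x y x' y'
    assume *: "x \<in> F2 m" "y \<in> Y" "x' \<in> F2 m" "y' \<in> Y" "\<Phi> (x, y) = \<Phi> (x', y')"
    have F: "y \<in> F2 k" "y' \<in> F2 k" "y0 \<in> F2 k"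
      using * y0 YF by auto
    have \<Phi>: "\<Phi> (x, y) = (i x, s (i x) + (x @\<^sub>v (g x + (y0 + y))))"
      if "x \<in> F2 m" "y \<in> F2 k" for x y
    proof -
      have "h x + (0\<^sub>v m @\<^sub>v (y0 + y)) = s (i x) + ((x @\<^sub>v g x) + (0\<^sub>v m @\<^sub>v (y0 + y)))"
        unfolding h_def using that ig[of x] s[of "i x"] F
        by (intro assoc_add_vec[of _ "m + k"]) auto
      also have "(x @\<^sub>v g x) + (0\<^sub>v m @\<^sub>v (y0 + y)) = (x + 0\<^sub>v m) @\<^sub>v (g x + (y0 + y))"
        using that ig[of x] F by (intro append_vec_add[of _ m _ _ k]) auto
      finally show ?thesis
        using that by (simp add: \<Phi>_def)
    qed
    have "i x = i x'"
      and "s (i x) + (x @\<^sub>v (g x + (y0 + y))) = s (i x') + (x' @\<^sub>v (g x' + (y0 + y')))"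
      using *(5) \<Phi>[OF *(1) F(1)] \<Phi>[OF *(3) F(2)] by auto
    then have "s (i x) + (s (i x) + (x @\<^sub>v (g x + (y0 + y))))
        = s (i x) + (s (i x) + (x' @\<^sub>v (g x' + (y0 + y'))))"
      by simp
    then have eq: "x @\<^sub>v (g x + (y0 + y)) = x' @\<^sub>v (g x' + (y0 + y'))"
      using F * ig[of x] ig[of x'] s[of "i x"]
      by (auto simp: F2_add_cancel[of _ "m + k"] app)
    then have eq': "x = x' \<and> g x + (y0 + y) = g x' + (y0 + y')"
      by (rule iffD1[OF append_vec_eq[OF *(1) *(3)]])
    then have "x = x'" ..
    from eq' have "g x + (y0 + y) = g x + (y0 + y')"
      unfolding \<open>x = x'\<close> by blast
    then have "g x + (g x + (y0 + y)) = g x + (g x + (y0 + y'))"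
      by simp
    then have "y0 + y = y0 + y'"
      using F * ig[of x] by (simp add: F2_add_cancel[of _ k])
    then have "y0 + (y0 + y) = y0 + (y0 + y')"
      by simp
    then show "x = x' \<and> y = y'"
      using F \<open>x = x'\<close> by (simp add: F2_add_cancel[of _ k])
  qed
  moreover have "\<Phi> ` (F2 m \<times> Y) \<subseteq> {..<r} \<times> H"
    using ig h diff_Y H(2) by (auto simp: \<Phi>_def)
  moreover have "finite H"
    using H(1) finite_F2 by (rule finite_subset)
  ultimately have "card (F2 m \<times> Y) \<le> card ({..<r} \<times> H)"
    by (intro card_inj_on_le) auto
  then have "2 ^ m * card Y \<le> r * card H"
    by (simp add: card_cartesian_product card_F2)
  also have "\<dots> \<le> r * 2 ^ m"
    using H(3) by simp
  finally show ?thesis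
    by (simp add: Y_def)
qed

text \<open>
  A cover by at most \<open>R\<close> cosets is written as a sequence of exactly \<open>\<lfloor>R\<rfloor>\<close> representatives, repeating
  one of them if necessary, because sequences are easy to count.
\<close>

lemma covered_by_cosetsE:
  assumes "covered_by_cosets n H R A" "A \<noteq> {}"
  obtains s where "s \<in> {..<nat \<lfloor>R\<rfloor>} \<rightarrow>\<^sub>E F2 n" "A \<subseteq> (\<Union>i<nat \<lfloor>R\<rfloor>. s i +o H)"
proof -
  define r where "r = nat \<lfloor>R\<rfloor>"
  obtain \<C> where \<C>: "\<C> \<subseteq> {x +o H | x. x \<in> F2 n}" "finite \<C>" "real (card \<C>) \<le> R" "A \<subseteq> \<Union>\<C>"
    using assms(1) by (auto simp: covered_by_cosets_def)
  have "card \<C> \<le> r"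
    using \<C>(3) unfolding r_def by linarith
  have "\<C> \<noteq> {}"
    using \<C>(4) assms(2) by auto
  obtain e where e: "bij_betw e {..<card \<C>} \<C>"
    using \<C>(2) ex_bij_betw_nat_finite[of \<C>] by (auto simp: atLeast0LessThan)
  obtain rep where rep: "\<And>D. D \<in> \<C> \<Longrightarrow> rep D \<in> F2 n \<and> D = rep D +o H"
    using \<C>(1) by (simp add: subset_iff) metis
  obtain D0 where "D0 \<in> \<C>" using \<open>\<C> \<noteq> {}\<close> by auto
  define s where "s = (\<lambda>i\<in>{..<r}. rep (if i < card \<C> then e i else D0))"
  have eC: "e i \<in> \<C>" if "i < card \<C>" for i
    using e that by (auto simp: bij_betw_def)
  have "s \<in> {..<r} \<rightarrow>\<^sub>E F2 n"
    using rep eC \<open>D0 \<in> \<C>\<close> by (auto simp: s_def)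
  moreover have "A \<subseteq> (\<Union>i<r. s i +o H)"
  proof
    fix v assume "v \<in> A"
    then obtain D where D: "D \<in> \<C>" "v \<in> D" using \<C>(4) by auto
    then obtain i where i: "i < card \<C>" "D = e i"
      using e by (auto simp: bij_betw_def)
    then have "s i +o H = D"
      using rep[OF D(1)] \<open>card \<C> \<le> r\<close> by (auto simp: s_def)
    then show "v \<in> (\<Union>i<r. s i +o H)"
      using i D \<open>card \<C> \<le> r\<close> by auto
  qed
  ultimately show thesis
    using that by (simp add: r_def)
qed

text \<open>
  The first factor counts the sequences of coset representatives. The second counts the maps for a
  fixed sequence: the \<open>j\<close>-th column lies in the union of the fibres of \<open>r\<close> cosets above the \<open>j\<close>-th unit
  vector, and each of these fibres has at most \<open>r\<close> elements.
\<close>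

lemma card_good_graphs_le:
  fixes K C :: real
  defines "r \<equiv> nat \<lfloor>(2 * K) powr C\<rfloor>"
  shows "card {f \<in> {..<m} \<rightarrow>\<^sub>E F2 k. good_output K C (m + k) (linear_graph m k f) H}
    \<le> (2 ^ (m + k)) ^ r * (r * r) ^ m" (is "card ?G \<le> _")
proof (cases "?G = {}")
  case True
  then show ?thesis by (metis card.empty zero_le)
next
  case False
  have H: "H \<subseteq> F2 (m + k)" "\<And>x y. x \<in> H \<Longrightarrow> y \<in> H \<Longrightarrow> x + y \<in> H" "card H \<le> 2 ^ m"
    using False linear_subspaceD[of "m + k" H]
    by (auto simp: good_output_def card_linear_graph)
  \<comment> \<open>Only sequences whose cosets project onto the whole first factor can cover a graph, and only for
    them are the fibres small.\<close>
  define S where "S = {s \<in> {..<r} \<rightarrow>\<^sub>E F2 (m + k). \<forall>x\<in>F2 m. \<exists>i<r. \<exists>y\<in>F2 k. x @\<^sub>v y \<in> s i +o H}"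
  define T where "T s j = {y \<in> F2 k. \<exists>i<r. unit_vec m j @\<^sub>v y \<in> s i +o H}" for s j
  have finS': "finite ({..<r} \<rightarrow>\<^sub>E F2 (m + k))"
    by (intro finite_PiE) auto
  then have finS: "finite S"
    by (simp add: S_def)
  have sub: "?G \<subseteq> (\<Union>s\<in>S. Pi\<^sub>E {..<m} (T s))"
  proof
    fix f assume "f \<in> ?G"
    then have f: "f \<in> {..<m} \<rightarrow>\<^sub>E F2 k"
      and cov: "covered_by_cosets (m + k) H ((2 * K) powr C) (linear_graph m k f)"
      by (auto simp: good_output_def)
    have "linear_graph m k f \<noteq> {}"
      using card_linear_graph[of m k f] by auto
    with cov obtain s where s: "s \<in> {..<r} \<rightarrow>\<^sub>E F2 (m + k)" "linear_graph m k f \<subseteq> (\<Union>i<r. s i +o H)"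
      unfolding r_def by (rule covered_by_cosetsE)
    have "\<exists>i<r. \<exists>y\<in>F2 k. x @\<^sub>v y \<in> s i +o H" if "x \<in> F2 m" for x
    proof -
      have "x @\<^sub>v (mat k m (\<lambda>(i, j). f j $ i) *\<^sub>v x) \<in> linear_graph m k f"
        using that by (simp add: linear_graph_def)
      with s(2) obtain i where "i < r" "x @\<^sub>v (mat k m (\<lambda>(i, j). f j $ i) *\<^sub>v x) \<in> s i +o H"
        by auto
      moreover have "mat k m (\<lambda>(i, j). f j $ i) *\<^sub>v x \<in> F2 k"
        using that by (intro mult_mat_vec_carrier) auto
      ultimately show ?thesis by blast
    qed
    with s(1) have "s \<in> S" by (simp add: S_def)
    moreover have "f \<in> Pi\<^sub>E {..<m} (T s)"
    proof (rule PiE_I)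
      fix j assume j: "j \<in> {..<m}"
      with f have "f j \<in> F2 k" by auto
      with j s(2) unit_vec_in_linear_graph[of j m f k] show "f j \<in> T s j"
        by (auto simp: T_def)
    next
      fix j assume "j \<notin> {..<m}"
      with f show "f j = undefined" by auto
    qed
    ultimately show "f \<in> (\<Union>s\<in>S. Pi\<^sub>E {..<m} (T s))" by blast
  qed
  have "card (T s j) \<le> r * r" if "s \<in> S" for s j
  proof -
    have "T s j = (\<Union>i<r. {y \<in> F2 k. unit_vec m j @\<^sub>v y \<in> s i +o H})"
      by (auto simp: T_def)
    also have "card \<dots> \<le> (\<Sum>i<r. card {y \<in> F2 k. unit_vec m j @\<^sub>v y \<in> s i +o H})"
      by (rule card_UN_le) simp
    also have "\<dots> \<le> (\<Sum>i<r. r)"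
      using that by (intro sum_mono card_fibre_le[OF H, where s = s]) (auto simp: S_def)
    finally show ?thesis by simp
  qed
  then have cT: "card (Pi\<^sub>E {..<m} (T s)) \<le> (r * r) ^ m" if "s \<in> S" for s
    using that prod_mono[of "{..<m}" "\<lambda>j. card (T s j)" "\<lambda>_. r * r"] by (simp add: card_PiE)
  have "card ?G \<le> card (\<Union>s\<in>S. Pi\<^sub>E {..<m} (T s))"
    using sub finS by (intro card_mono finite_UN_I finite_PiE) (auto simp: T_def)
  also have "\<dots> \<le> (\<Sum>s\<in>S. card (Pi\<^sub>E {..<m} (T s)))"
    by (rule card_UN_le[OF finS])
  also have "\<dots> \<le> (\<Sum>s\<in>S. (r * r) ^ m)"
    by (rule sum_mono) (rule cT)
  also have "\<dots> = card S * (r * r) ^ m"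
    by simp
  also have "card S \<le> (2 ^ (m + k)) ^ r"
    using card_mono[OF finS', of S] by (auto simp: S_def card_funcsetE card_F2)
  finally show ?thesis by simp
qed

section \<open>The lower bound\<close>

text \<open>
  Comparing the two estimates of the total success probability gives
  \<open>2\<^bsup>mk\<^esup> n\<^bsup>-a\<^esup> \<le> 2\<^sup>t 2\<^bsup>nr\<^esup> (r\<^sup>2)\<^sup>m\<close>; the crude bounds \<open>r \<le> 2\<^sup>r\<close> and \<open>n \<le> 2\<^sup>n\<close> make all
  factors powers of two, so that the exponents can be compared.
\<close>

lemma queries_lower_bound:
  fixes K C a :: real
  defines "r \<equiv> nat \<lfloor>(2 * K) powr C\<rfloor>"
  assumes K: "K \<ge> 1" and n: "n > 0" and a: "a > 0"
    and queries: "makes_at_most_queries n t alg"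
    and succ: "succeeds K C a n alg"
  shows "real n ^ 2 / 4 - 1 / 4 - (2 * real r + a) * real n \<le> real t"
proof -
  define m where "m = n div 2"
  define k where "k = n - m"
  have mk: "m + k = n"
    by (simp add: m_def k_def)
  define I where "I = {..<m} \<rightarrow>\<^sub>E F2 k"
  have finI: "finite I"
    unfolding I_def by (intro finite_PiE) auto
  have cardI: "card I = 2 ^ (m * k)"
    by (simp add: I_def card_funcsetE card_F2 power_mult[symmetric] mult.commute)
  have each: "real n powr (- a) \<le> output_prob (linear_graph m k f) alg (good_output K C n (linear_graph m k f))" for f
  proof -
    let ?A = "linear_graph m k f"
    have "?A \<subseteq> F2 n"
      using linear_graph_subset[of m k f] mk by simp
    moreover have "?A \<noteq> {}"
      using card_linear_graph[of m k f] by auto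
    moreover have "card (?A + ?A) \<le> card ?A"
      using \<open>?A \<subseteq> F2 n\<close> finite_F2 linear_graph_sumset by (intro card_mono) (auto intro: finite_subset)
    then have "real (card (?A + ?A)) \<le> K * real (card ?A)"
      using K mult_right_mono[of 1 K "real (card ?A)"] by simp
    ultimately show ?thesis
      using succ by (simp add: succeeds_def)
  qed
  have "real (card I) * real n powr (- a) = (\<Sum>f\<in>I. real n powr (- a))"
    by simp
  also have "\<dots> \<le> (\<Sum>f\<in>I. output_prob (linear_graph m k f) alg (good_output K C n (linear_graph m k f)))"
    by (rule sum_mono) (rule each)
  also have "\<dots> \<le> 2 ^ t * real ((2 ^ n) ^ r * (r * r) ^ m)"
  proof (rule sum_output_prob_le[OF finI])
    show "card {f \<in> I. good_output K C n (linear_graph m k f) H} \<le> (2 ^ n) ^ r * (r * r) ^ m" for H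
      using card_good_graphs_le[of m k K C H] by (simp add: I_def mk r_def)
    show "q \<le> t" if "(H, q) \<in> set_pmf (run (membership_oracle (linear_graph m k f)) alg)" for f H q
    proof -
      have "linear_graph m k f \<subseteq> F2 n"
        using linear_graph_subset[of m k f] mk by simp
      with queries that show ?thesis
        unfolding makes_at_most_queries_def by blast
    qed
  qed
  also have "(r * r) ^ m \<le> (2 ^ n) ^ r"
  proof -
    have "r * r \<le> 2 ^ r * 2 ^ r"
      by (intro mult_mono less_imp_le[OF less_exp]) simp_all
    then have "(r * r) ^ m \<le> (2 ^ r * 2 ^ r) ^ m"
      by (rule power_mono) simp
    also have "\<dots> = 2 ^ (2 * m * r)"
      by (simp add: power_add[symmetric] power_mult[symmetric] mult_2 ac_simps)
    also have "\<dots> \<le> 2 ^ (n * r)"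
      by (intro power_increasing mult_right_mono) (simp_all add: m_def)
    finally show ?thesis
      by (simp add: power_mult)
  qed
  finally have le: "real (2 ^ (m * k)) * real n powr (- a) \<le> 2 ^ t * real ((2 ^ n) ^ r * (2 ^ n) ^ r)"
    by (simp add: cardI)
  have "real n \<le> 2 powr real n"
    using of_nat_less_two_power[of n] by (simp add: powr_realpow)
  then have "real n powr a \<le> (2 powr real n) powr a"
    using n a by (intro powr_mono2) auto
  also have "\<dots> = 2 powr (a * real n)"
    by (simp add: powr_powr mult.commute)
  finally have na: "real n powr a \<le> 2 powr (a * real n)" .
  have "2 powr (real m * real k) = real (2 ^ (m * k)) * real n powr (- a) * real n powr a"
  proof -
    have "real n powr (- a) * real n powr a = 1"
      using n by (simp add: powr_add[symmetric])
    moreover have "real (2 ^ (m * k)) = 2 powr (real m * real k)"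
      using powr_realpow[of 2 "m * k"] by simp
    ultimately show ?thesis
      by (simp only: mult.assoc mult_1_right)
  qed
  also have "\<dots> \<le> 2 ^ t * real ((2 ^ n) ^ r * (2 ^ n) ^ r) * 2 powr (a * real n)"
    by (rule mult_mono[OF le na]) auto
  also have "\<dots> = 2 powr (real t + 2 * real n * real r + a * real n)"
  proof -
    have "real ((2 ^ n) ^ r * (2 ^ n) ^ r) = 2 ^ (2 * n * r)"
      by (simp add: power_mult[symmetric] power_add[symmetric] mult_2 distrib_right)
    also have "\<dots> = 2 powr (2 * real n * real r)"
      using powr_realpow[of 2 "2 * n * r"] by simp
    finally show ?thesis
      by (simp only: powr_add powr_realpow zero_less_numeral)
  qed
  finally have "real m * real k \<le> real t + 2 * real n * real r + a * real n"
    by simp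
  moreover have "real n ^ 2 / 4 - 1 / 4 \<le> real m * real k"
  proof -
    have "4 * (m * k) + 1 \<ge> n ^ 2"
    proof (cases "even n")
      case True
      then show ?thesis
        by (auto simp: m_def k_def power2_eq_square elim!: evenE)
    next
      case False
      then show ?thesis
        by (auto simp: m_def k_def power2_eq_square elim!: oddE)
    qed
    then have "real (n ^ 2) \<le> real (4 * (m * k) + 1)"
      by (simp only: of_nat_le_iff)
    then show ?thesis by simp
  qed
  ultimately show ?thesis
    by (simp add: algebra_simps)
qed

theorem theorem5p1:
  fixes K :: real
  assumes "K \<ge> 1"
  shows "\<exists>c>0. \<forall>C>0. \<forall>a>0. \<exists>N. \<forall>(t :: nat \<Rightarrow> nat) (alg :: nat \<Rightarrow> bit vec set query_alg) n\<^sub>0.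
           (\<forall>n. makes_at_most_queries n (t n) (alg n)) \<and>
           (\<forall>n\<ge>n\<^sub>0. succeeds K C a n (alg n)) \<longrightarrow>
           (\<forall>n\<ge>max N n\<^sub>0. real (t n) \<ge> c * real n ^ 2)"
proof (intro exI[of _ "1 / 8 :: real"] conjI allI impI)
  fix C a :: real
  assume "C > 0" "a > 0"
  define b where "b = 2 * real (nat \<lfloor>(2 * K) powr C\<rfloor>) + a"
  \<comment> \<open>From here on \<open>b n + 1/4 \<le> n\<^sup>2 / 8\<close>, so the lower-order terms use up half of \<open>n\<^sup>2 / 4\<close>.\<close>
  define N where "N = nat \<lceil>8 * b\<rceil> + 2"
  have "real (t n) \<ge> 1 / 8 * real n ^ 2"
    if "\<forall>n. makes_at_most_queries n (t n) (alg n)"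
      and "\<forall>n\<ge>n\<^sub>0. succeeds K C a n (alg n)"
      and "n \<ge> max N n\<^sub>0" for t alg n\<^sub>0 n
  proof -
    have "n \<ge> 2" and nb: "real n \<ge> 8 * b + 2"
      using that(3) by (auto simp: N_def) linarith
    have "real n ^ 2 / 4 - 1 / 4 - b * real n \<le> real (t n)"
      unfolding b_def
      using that \<open>K \<ge> 1\<close> \<open>a > 0\<close> \<open>n \<ge> 2\<close> by (intro queries_lower_bound[where alg = "alg n"]) auto
    moreover have "(8 * b + 2) * real n \<le> real n * real n"
      using nb by (intro mult_right_mono) auto
    ultimately show ?thesis
      using \<open>n \<ge> 2\<close> by (simp add: power2_eq_square algebra_simps)
  qed
  then show "\<exists>N. \<forall>(t :: nat \<Rightarrow> nat) (alg :: nat \<Rightarrow> bit vec set query_alg) n\<^sub>0.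
           (\<forall>n. makes_at_most_queries n (t n) (alg n)) \<and>
           (\<forall>n\<ge>n\<^sub>0. succeeds K C a n (alg n)) \<longrightarrow>
           (\<forall>n\<ge>max N n\<^sub>0. real (t n) \<ge> 1 / 8 * real n ^ 2)"
    by blast
qed simp

end
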